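(* Let $\alpha\ge 0$ and $k\ge 1$ be integers, let $p_1,\ldots,p_k$ be distinct odd primes and $\alpha_1,\ldots,\alpha_k$ positive integers, and let $n=2^{\alpha}\prod_{i=1}^{k}p_i^{\alpha_i}>8$. Let $R=\{r_i : p_i\equiv r_i \pmod 8,\ 0\le r_i\le 7,\ 1\le i\le k\}$ be the set of residues of the $p_i$ modulo $8$. Then $$\varphi_8(n)=\begin{cases} \frac18\varphi(n)+\frac14(-1)^{\Omega(n)}2^{\omega(n)-\alpha}, & \text{if } \alpha\in\{0,1\} \text{ and } R=\{5,7\} \text{ or } R=\{5\};\\[2pt] \frac18\varphi(n)+\frac18(-1)^{\Omega(n)-\lfloor(\alpha+1)/2\rfloor}2^{\omega(n)-\frac12(1-(-1)^{\alpha})}, & \text{if } \alpha\in\{0,1,2\} \text{ and } R=\{3,7\} \text{ or } R=\{3\};\\[2pt] \frac18\varphi(n)+\frac18(-1)^{\Omega(n)-\lfloor\alpha/2\rfloor}2^{\omega(n)-\frac12(1-(-1)^{\alpha})}+\frac{1-\lfloor(\alpha+1)/2\rfloor}{4}(-1)^{\Omega(n)}2^{\omega(n)}, & \text{if } \alpha\in\{0,1,2\} \text{ and } R=\{7\};\\[2pt] \frac18\varphi(n), & \text{otherwise}. \end{cases}$$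
   Context: For positive integers $n,e$, the generalized Euler function is $\varphi_e(n)=\#\{i\in\mathbb{Z}: 1\le i\le \lfloor n/e\rfloor,\ \gcd(i,n)=1\}$; $\varphi=\varphi_1$ is Euler's function. $\Omega(n)$ denotes the number of prime factors of $n$ counted with multiplicity and $\omega(n)$ the number of distinct prime factors of $n$. $\lfloor x\rfloor$ is the greatest integer not exceeding $x$. Conditions such as "$R=\{5,7\}$" mean equality of sets. *)

theory Defs
  imports Complex_Main "HOL-Number_Theory.Number_Theory"
begin

(* On nat, n div e is the floor of n / e.  Meaningful for e > 0 only: n div 0 = 0 in HOL. *)
definition gen_totient :: "nat \<Rightarrow> nat \<Rightarrow> nat" where
  "gen_totient e n = card {i. 1 \<le> i \<and> i \<le> n div e \<and> gcd i n = 1}"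

lemma gen_totient_1: "gen_totient 1 n = totient n"
proof -
  have "{i. 1 \<le> i \<and> i \<le> n div 1 \<and> gcd i n = 1} = totatives n"
    unfolding totatives_def coprime_iff_gcd_eq_1 by force
  then show ?thesis
    by (simp add: gen_totient_def totient_def)
qed

definition big_omega :: "nat \<Rightarrow> nat" where
  "big_omega n = size (prime_factorization n)"

definition small_omega :: "nat \<Rightarrow> nat" where
  "small_omega n = card (prime_factors n)"

end

theory Submission
  imports Defs
begin

text \<open>
  The number of \<open>i \<le> x\<close> with no prime factor in \<open>P\<close> satisfies Legendre's
  recursion: adjoining a prime \<open>p\<close> to \<open>P\<close> subtracts the count for
  \<open>x div p\<close>. For \<open>x = N div 8\<close> with \<open>p dvd N\<close>, this replaces \<open>N\<close> by \<open>N div p\<close>.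
  Now \<open>8 * (N div 8) = N - N mod 8\<close> and, for odd \<open>m\<close>, the residue \<open>2 ^ b * m mod 8\<close> is a
  linear combination of the constant 1 and the real characters of conductor 4 and 8 that are odd.
  The recursion turns the contribution of such a character \<open>f\<close> into
  \<open>f m * (\<Prod>p\<in>P. 1 - f p)\<close>, which vanishes unless \<open>f p = - 1\<close> for every \<open>p\<close>,
  a condition on the residues of the primes modulo 8.
\<close>

section \<open>Sifted counts and Legendre's recursion\<close>

definition sifted :: "nat set \<Rightarrow> nat \<Rightarrow> nat" where
  "sifted P x = card {i \<in> {1..x}. \<forall>p\<in>P. \<not> p dvd i}"

lemma sifted_empty [simp]: "sifted {} x = x"
proof -
  have "{i \<in> {1..x}. \<forall>p\<in>{}. \<not> p dvd i} = {1..x}" by auto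
  then show ?thesis by (simp add: sifted_def)
qed

text \<open>The multiples of \<open>p\<close> removed by the new condition are \<open>p * i\<close>
  with \<open>i \<le> x div p\<close>. Since \<open>p\<close> is a prime outside \<open>P\<close>, a
  prime of \<open>P\<close> divides \<open>p * i\<close> only if it divides
  \<open>i\<close>.\<close>

lemma sifted_insert:
  assumes "prime p" "\<And>q. q \<in> P \<Longrightarrow> prime q" "p \<notin> P"
  shows "sifted (insert p P) x + sifted P (x div p) = sifted P x"
proof -
  define A where "A = {i \<in> {1..x}. \<forall>q\<in>insert p P. \<not> q dvd i}"
  define B where "B = {i \<in> {1..x div p}. \<forall>q\<in>P. \<not> q dvd i}"
  have "p > 0"
    using assms(1) prime_gt_0_nat by blast
  have dvd_iff: "q dvd p * i \<longleftrightarrow> q dvd i" if "q \<in> P" for q i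
    using assms that by (metis prime_dvd_mult_iff primes_dvd_imp_eq)
  have "{i \<in> {1..x}. \<forall>q\<in>P. \<not> q dvd i} = A \<union> (\<lambda>i. p * i) ` B"
  proof (intro equalityI subsetI)
    fix i assume i: "i \<in> {i \<in> {1..x}. \<forall>q\<in>P. \<not> q dvd i}"
    show "i \<in> A \<union> (\<lambda>i. p * i) ` B"
    proof (cases "p dvd i")
      case True
      then obtain j where j: "i = p * j" by blast
      have "j \<in> B"
        using i \<open>p > 0\<close> by (auto simp: B_def j dvd_iff less_eq_div_iff_mult_less_eq mult.commute)
      then show ?thesis using j by blast
    next
      case False
      then show ?thesis using i by (auto simp: A_def)
    qed
  next
    fix i assume "i \<in> A \<union> (\<lambda>i. p * i) ` B"
    then show "i \<in> {i \<in> {1..x}. \<forall>q\<in>P. \<not> q dvd i}"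
      using \<open>p > 0\<close>
      by (auto simp: A_def B_def dvd_iff less_eq_div_iff_mult_less_eq mult.commute[of _ p])
  qed
  moreover have "A \<inter> (\<lambda>i. p * i) ` B = {}"
    by (auto simp: A_def)
  moreover have "finite A" "finite B"
    by (auto simp: A_def B_def)
  moreover have "card ((\<lambda>i. p * i) ` B) = card B"
    using \<open>p > 0\<close> by (intro card_image) (auto simp: inj_on_def)
  ultimately show ?thesis
    unfolding sifted_def A_def[symmetric] B_def[symmetric] by (simp add: card_Un_disjoint)
qed

lemma gen_totient_eq_sifted:
  assumes "n > 0"
  shows "gen_totient e n = sifted (prime_factors n) (n div e)"
proof -
  have "gcd i n = 1 \<longleftrightarrow> (\<forall>p\<in>prime_factors n. \<not> p dvd i)" for i
  proof
    assume "gcd i n = 1"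
    then show "\<forall>p\<in>prime_factors n. \<not> p dvd i"
      by (metis in_prime_factors_iff gcd_greatest nat_dvd_1_iff_1 not_prime_1)
  next
    assume *: "\<forall>p\<in>prime_factors n. \<not> p dvd i"
    show "gcd i n = 1"
    proof (rule ccontr)
      assume "gcd i n \<noteq> 1"
      then obtain p where "prime p" "p dvd gcd i n"
        using prime_factor_nat by blast
      then show False
        using * assms by (auto simp: in_prime_factors_iff)
    qed
  qed
  then show ?thesis
    unfolding gen_totient_def sifted_def by (intro arg_cong[where f = card]) auto
qed

text \<open>The Kronecker symbols of -4 and -8.\<close>

definition chi4 :: "nat \<Rightarrow> real" where
  "chi4 m = (if even m then 0 else if m mod 8 \<in> {1, 5} then 1 else - 1)"

definition chi8 :: "nat \<Rightarrow> real" where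
  "chi8 m = (if even m then 0 else if m mod 8 \<in> {1, 3} then 1 else - 1)"

lemma odd_mod_8:
  fixes m :: nat
  assumes "odd m"
  shows "m mod 8 = 1 \<or> m mod 8 = 3 \<or> m mod 8 = 5 \<or> m mod 8 = 7"
  using assms by presburger

lemma chi4_mult: "chi4 (m * n) = chi4 m * chi4 n"
proof (cases "odd m \<and> odd n")
  case True
  moreover have "m * n mod 8 = (m mod 8) * (n mod 8) mod 8"
    by (simp add: mod_mult_eq)
  ultimately show ?thesis
    using odd_mod_8[of m] odd_mod_8[of n] by (auto simp: chi4_def)
qed (auto simp: chi4_def)

lemma chi8_mult: "chi8 (m * n) = chi8 m * chi8 n"
proof (cases "odd m \<and> odd n")
  case True
  moreover have "m * n mod 8 = (m mod 8) * (n mod 8) mod 8"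
    by (simp add: mod_mult_eq)
  ultimately show ?thesis
    using odd_mod_8[of m] odd_mod_8[of n] by (auto simp: chi8_def)
qed (auto simp: chi8_def)

lemma chi_1 [simp]: "chi4 1 = 1" "chi8 1 = 1" "chi4 (Suc 0) = 1" "chi8 (Suc 0) = 1"
  by (simp_all add: chi4_def chi8_def)

text \<open>Induction on \<open>P\<close>, starting from \<open>8 * (N div 8) = N - N mod 8\<close>.
  Adjoining \<open>p\<close> subtracts the formula at m/p from the one at \<open>m\<close>, so the
  leading term gains the factor 1 - 1/p and each character term its factor 1 - chi(p). The constant
  \<open>c\<close> cancels at the first prime.\<close>

lemma sifted_expansion:
  fixes c d e :: real
  assumes "\<And>m. odd m \<Longrightarrow> real (2 ^ b * m mod 8) = c - d * chi4 m - e * chi8 m"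
    and "finite P" "\<And>p. p \<in> P \<Longrightarrow> prime p \<and> odd p" "odd m" "\<Prod>P dvd m"
  shows "8 * real (sifted P (2 ^ b * m div 8)) =
    2 ^ b * real m * (\<Prod>p\<in>P. 1 - 1 / real p) - (if P = {} then c else 0)
      + d * chi4 m * (\<Prod>p\<in>P. 1 - chi4 p) + e * chi8 m * (\<Prod>p\<in>P. 1 - chi8 p)"
  using assms(2-)
proof (induction P arbitrary: m rule: finite_induct)
  case empty
  have "8 * real (2 ^ b * m div 8) + real (2 ^ b * m mod 8) = 2 ^ b * real m"
    by (metis mult_div_mod_eq of_nat_add of_nat_mult of_nat_numeral of_nat_power)
  with assms(1)[OF empty(2)] show ?case by simp
next
  case (insert p P)
  have p: "prime p" "odd p" and P: "\<And>q. q \<in> P \<Longrightarrow> prime q \<and> odd q"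
    using insert.prems by auto
  from insert.prems(3) insert.hyps obtain t where t: "m = p * (\<Prod>P * t)"
    by (auto simp: dvd_def mult.assoc)
  define m' where "m' = \<Prod>P * t"
  have m: "m = p * m'" using t by (simp add: m'_def)
  have "odd m'" "\<Prod>P dvd m'"
    using insert.prems m by (auto simp: m'_def)
  have "\<Prod>P dvd m" using \<open>\<Prod>P dvd m'\<close> m by simp
  have "p > 0" using p prime_gt_0_nat by blast
  \<comment> \<open>Nested floors merge, so the subtracted count has the shape required by the
    induction hypothesis, with \<open>m'\<close> for \<open>m\<close>.\<close>
  have "2 ^ b * m div 8 div p = 2 ^ b * m' div 8"
  proof -
    have "2 ^ b * m div 8 div p = p * (2 ^ b * m') div (p * 8)"
      by (simp add: m div_mult2_eq[symmetric] ac_simps)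
    then show ?thesis using \<open>p > 0\<close> by simp
  qed
  then have rec: "real (sifted (insert p P) (2 ^ b * m div 8)) =
      real (sifted P (2 ^ b * m div 8)) - real (sifted P (2 ^ b * m' div 8))"
    using sifted_insert[of p P "2 ^ b * m div 8"] p P insert.hyps by auto
  have IH: "8 * real (sifted P (2 ^ b * l div 8)) =
      2 ^ b * real l * (\<Prod>p\<in>P. 1 - 1 / real p) - (if P = {} then c else 0)
        + d * chi4 l * (\<Prod>p\<in>P. 1 - chi4 p) + e * chi8 l * (\<Prod>p\<in>P. 1 - chi8 p)"
    if "odd l" "\<Prod>P dvd l" for l
    using insert.IH[OF _ that] P by blast
  \<comment> \<open>The character values at the odd prime \<open>p\<close> are 1 or -1. Hence
    chi(m') = chi(p) chi(m), which makes chi(m) - chi(m') equal to chi(m) (1 - chi(p)).\<close>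
  have sq: "chi4 p * (chi4 p * x) = x" "chi8 p * (chi8 p * x) = x" for x
    using p by (auto simp: chi4_def chi8_def)
  have "8 * real (sifted (insert p P) (2 ^ b * m div 8)) =
      8 * real (sifted P (2 ^ b * m div 8)) - 8 * real (sifted P (2 ^ b * m' div 8))"
    using rec by simp
  also have "\<dots> = 2 ^ b * real m * (\<Prod>p\<in>insert p P. 1 - 1 / real p)
      + d * chi4 m * (\<Prod>p\<in>insert p P. 1 - chi4 p) + e * chi8 m * (\<Prod>p\<in>insert p P. 1 - chi8 p)"
    unfolding IH[OF \<open>odd m\<close> \<open>\<Prod>P dvd m\<close>] IH[OF \<open>odd m'\<close> \<open>\<Prod>P dvd m'\<close>]
    using insert.hyps \<open>p > 0\<close>
    by (simp add: m chi4_mult chi8_mult algebra_simps sq)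
  finally show ?case by simp
qed

text \<open>A single value \<open>f i = 1\<close> kills the second product; otherwise each of its
  factors is 2.\<close>

lemma prod_character:
  fixes f :: "'a \<Rightarrow> real"
  assumes "finite I" "\<And>i. i \<in> I \<Longrightarrow> f i = 1 \<or> f i = - 1"
  shows "(\<Prod>i\<in>I. f i ^ a i) * (\<Prod>i\<in>I. 1 - f i) =
    (if \<forall>i\<in>I. f i = - 1 then (- 1) ^ sum a I * 2 ^ card I else 0)"
proof (cases "\<forall>i\<in>I. f i = - 1")
  case True
  then show ?thesis by (simp add: power_sum cong: prod.cong)
next
  case False
  then obtain i where "i \<in> I" "f i = 1" using assms(2) by blast
  then have "(\<Prod>i\<in>I. 1 - f i) = 0"
    using assms(1) by (intro prod_zero) auto
  with False show ?thesis by simp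
qed

text \<open>For \<open>b < 3\<close> the residue minus 4 changes sign or vanishes under m -> -m, so
  only odd characters enter; the coefficients are checked on 1, 3, 5, 7. Factors 0 and 1 are written
  out to match the hypothesis of \<open>sifted_expansion\<close>.\<close>

lemma mod_8_expansion:
  assumes "odd m"
  shows "real (2 ^ 0 * m mod 8) = 4 - 1 * chi4 m - 2 * chi8 m"
    and "real (2 ^ 1 * m mod 8) = 4 - 2 * chi4 m - 0 * chi8 m"
    and "real (2 ^ 2 * m mod 8) = 4 - 0 * chi4 m - 0 * chi8 m"
    and "b \<ge> 3 \<Longrightarrow> real (2 ^ b * m mod 8) = 0 - 0 * chi4 m - 0 * chi8 m"
proof -
  have *: "c * m mod 8 = (c mod 8) * (m mod 8) mod 8" for c
    by (simp add: mod_mult_eq)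
  show "real (2 ^ 0 * m mod 8) = 4 - 1 * chi4 m - 2 * chi8 m"
    "real (2 ^ 1 * m mod 8) = 4 - 2 * chi4 m - 0 * chi8 m"
    "real (2 ^ 2 * m mod 8) = 4 - 0 * chi4 m - 0 * chi8 m"
    using odd_mod_8[OF assms] assms by (auto simp: * chi4_def chi8_def)
  assume "b \<ge> 3"
  then have "(2::nat) ^ 3 dvd 2 ^ b" by (rule le_imp_power_dvd)
  then show "real (2 ^ b * m mod 8) = 0 - 0 * chi4 m - 0 * chi8 m"
    by simp
qed

lemma prime_factorization_prod_powers:
  fixes p a :: "'a \<Rightarrow> nat"
  assumes "finite I" "\<And>i. i \<in> I \<Longrightarrow> prime (p i)"
  shows "prime_factorization (\<Prod>i\<in>I. p i ^ a i) = (\<Sum>i\<in>I. replicate_mset (a i) (p i))"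
proof -
  have "0 \<notin> (\<lambda>i. p i ^ a i) ` I"
    using assms(2) by fastforce
  then show ?thesis
    using assms by (subst prime_factorization_prod)
      (auto intro!: sum.cong simp: prime_factorization_prime_power)
qed

theorem theorem3p1:
  fixes \<alpha> k n :: nat and p a :: "nat \<Rightarrow> nat" and R :: "nat set"
  assumes "k \<ge> 1"
    and "\<And>i. i \<in> {1..k} \<Longrightarrow> prime (p i) \<and> odd (p i)"
    and "inj_on p {1..k}"
    and "\<And>i. i \<in> {1..k} \<Longrightarrow> a i > 0"
    and "n = 2 ^ \<alpha> * (\<Prod>i\<in>{1..k}. p i ^ a i)"
    and "n > 8"
    and "R = {r. 0 \<le> r \<and> r \<le> 7 \<and> (\<exists>i\<in>{1..k}. [p i = r] (mod 8))}"
  shows "real (gen_totient 8 n) =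
    (if \<alpha> \<in> {0, 1} \<and> (R = {5, 7} \<or> R = {5}) then
       1 / 8 * real (totient n)
         + 1 / 4 * (-1) ^ big_omega n * 2 powi (int (small_omega n) - int \<alpha>)
     else if \<alpha> \<in> {0, 1, 2} \<and> (R = {3, 7} \<or> R = {3}) then
       1 / 8 * real (totient n)
         + 1 / 8 * (-1) powi (int (big_omega n) - int ((\<alpha> + 1) div 2))
             * 2 powi (int (small_omega n) - (1 - (-1) ^ \<alpha>) div 2)
     else if \<alpha> \<in> {0, 1, 2} \<and> R = {7} then
       1 / 8 * real (totient n)
         + 1 / 8 * (-1) powi (int (big_omega n) - int (\<alpha> div 2))
             * 2 powi (int (small_omega n) - (1 - (-1) ^ \<alpha>) div 2)
         + (1 - real ((\<alpha> + 1) div 2)) / 4 * (-1) ^ big_omega n * 2 ^ small_omega n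
     else 1 / 8 * real (totient n))"
proof -
  define I where "I = {1..k}"
  define m where "m = (\<Prod>i\<in>I. p i ^ a i)"
  define P where "P = p ` I"
  define s where "s = sum a I"
  \<comment> \<open>The value of chi(m) times the product of 1 - chi(p) when chi(p) = -1 for all p
    in \<open>P\<close>, the same for both characters.\<close>
  define A :: real where "A = (- 1) ^ s * 2 ^ k"
  have I: "finite I" "I \<noteq> {}" "card I = k" "inj_on p I"
    "\<And>i. i \<in> I \<Longrightarrow> prime (p i)" "\<And>i. i \<in> I \<Longrightarrow> odd (p i)" "\<And>i. i \<in> I \<Longrightarrow> a i > 0"
    using assms by (auto simp: I_def)
  have n: "n = 2 ^ \<alpha> * m" using assms(5) by (simp add: m_def I_def)
  have P: "finite P" "P \<noteq> {}" "card P = k" "\<And>q. q \<in> P \<Longrightarrow> prime q \<and> odd q"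
    using I by (auto simp: P_def card_image)
  then have "2 \<notin> P" by (metis even_numeral)
  have "odd m"
    using I by (auto simp: m_def even_prod_iff)
  then have "m > 0" by (rule odd_pos)
  have "n > 0" using assms(6) by simp
  have "\<Prod>P dvd m"
  proof -
    have "\<Prod>P = (\<Prod>i\<in>I. p i)"
      unfolding P_def using I(4) by (simp add: prod.reindex)
    also have "\<dots> dvd m"
      unfolding m_def using I(7) by (intro prod_dvd_prod dvd_power) auto
    finally show ?thesis .
  qed

  \<comment> \<open>Factorization of \<open>n\<close>\<close>
  have pf: "prime_factorization n = replicate_mset \<alpha> 2 + (\<Sum>i\<in>I. replicate_mset (a i) (p i))"
    using \<open>m > 0\<close> I prime_factorization_prod_powers[of I p a]
    by (simp add: n prime_factorization_mult prime_factorization_prime_power m_def[symmetric])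
  have Omega: "big_omega n = \<alpha> + s"
    by (simp add: big_omega_def pf s_def size_multiset_sum)
  have pfs: "prime_factors n = (if \<alpha> = 0 then {} else {2}) \<union> P"
    using I(7) I(1) by (auto simp: pf P_def set_mset_sum)
  have omega: "small_omega n = (if \<alpha> = 0 then k else Suc k)"
    using P \<open>2 \<notin> P\<close> by (simp add: small_omega_def pfs)

  \<comment> \<open>Character contributions in terms of \<open>R\<close>\<close>
  have chi4_m: "chi4 m = (\<Prod>i\<in>I. chi4 (p i) ^ a i)"
  proof -
    have "chi4 (q ^ j) = chi4 q ^ j" for q j
      by (induction j) (auto simp: chi4_mult)
    moreover have "chi4 (\<Prod>i\<in>J. f i) = (\<Prod>i\<in>J. chi4 (f i))" if "finite J" for J :: "nat set" and f
      using that by induction (auto simp: chi4_mult)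
    ultimately show ?thesis using I by (simp add: m_def)
  qed
  have chi8_m: "chi8 m = (\<Prod>i\<in>I. chi8 (p i) ^ a i)"
  proof -
    have "chi8 (q ^ j) = chi8 q ^ j" for q j
      by (induction j) (auto simp: chi8_mult)
    moreover have "chi8 (\<Prod>i\<in>J. f i) = (\<Prod>i\<in>J. chi8 (f i))" if "finite J" for J :: "nat set" and f
      using that by induction (auto simp: chi8_mult)
    ultimately show ?thesis using I by (simp add: m_def)
  qed

  have R: "R = (\<lambda>i. p i mod 8) ` I"
    unfolding assms(7) I_def[symmetric]
  proof (intro equalityI subsetI)
    fix r assume "r \<in> (\<lambda>i. p i mod 8) ` I"
    then show "r \<in> {r. 0 \<le> r \<and> r \<le> 7 \<and> (\<exists>i\<in>I. [p i = r] (mod 8))}"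
      using pos_mod_bound by (auto simp: cong_def)
  qed (auto simp: cong_def)
  then have "R \<noteq> {}" using I by simp
  have "chi4 (p i) = - 1 \<longleftrightarrow> p i mod 8 \<in> {3, 7}" "chi8 (p i) = - 1 \<longleftrightarrow> p i mod 8 \<in> {5, 7}"
    if "i \<in> I" for i
    using odd_mod_8[OF I(6)[OF that]] I(6)[OF that] by (auto simp: chi4_def chi8_def)
  then have all: "(\<forall>i\<in>I. chi4 (p i) = - 1) \<longleftrightarrow> R \<subseteq> {3, 7}"
    "(\<forall>i\<in>I. chi8 (p i) = - 1) \<longleftrightarrow> R \<subseteq> {5, 7}"
    by (auto simp: R)
  have E4: "chi4 m * (\<Prod>q\<in>P. 1 - chi4 q) = (if R \<subseteq> {3, 7} then A else 0)"
    unfolding P_def prod.reindex[OF I(4)] chi4_m comp_def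
    using I by (subst prod_character) (auto simp: chi4_def all A_def s_def simp flip: all)
  have E8: "chi8 m * (\<Prod>q\<in>P. 1 - chi8 q) = (if R \<subseteq> {5, 7} then A else 0)"
    unfolding P_def prod.reindex[OF I(4)] chi8_m comp_def
    using I by (subst prod_character) (auto simp: chi8_def all A_def s_def simp flip: all)

  \<comment> \<open>This is Euler's function of the odd part \<open>m\<close>, as \<open>P\<close>
    is the set of primes dividing \<open>m\<close>.\<close>
  define T where "T = real m * (\<Prod>q\<in>P. 1 - 1 / real q)"
  define B4 where "B4 = (if R \<subseteq> {3, 7} then A else 0)"
  define B8 where "B8 = (if R \<subseteq> {5, 7} then A else 0)"
  \<comment> \<open>The constant \<open>c\<close> is gone because \<open>P\<close> is
    nonempty.\<close>
  have expand: "8 * real (sifted P (2 ^ b * m div 8)) = 2 ^ b * T + d * B4 + e * B8"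
    if "\<And>m. odd m \<Longrightarrow> real (2 ^ b * m mod 8) = c - d * chi4 m - e * chi8 m" for b c d e
    using sifted_expansion[OF that P(1,4) \<open>odd m\<close> \<open>\<Prod>P dvd m\<close>] P(2)
    by (simp add: T_def B4_def B8_def mult.assoc flip: E4 E8)
  note S0 = expand[OF mod_8_expansion(1)] and S1 = expand[OF mod_8_expansion(2)]
    and S2 = expand[OF mod_8_expansion(3)] and S3 = expand[OF mod_8_expansion(4)]
  have tot: "real (totient n) = (if \<alpha> = 0 then T else 2 ^ (\<alpha> - 1) * T)"
  proof -
    have "real (totient n) = real (2 ^ \<alpha> * m) *
        (\<Prod>q\<in>(if \<alpha> = 0 then {} else {2}) \<union> P. 1 - 1 / real q)"
      unfolding totient_formula2 pfs by (simp add: n)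
    then show ?thesis
      using P \<open>2 \<notin> P\<close> by (cases \<alpha>) (simp_all add: T_def)
  qed
  \<comment> \<open>The expansion covers odd primes only, so 2 is adjoined last, by one more use of
    Legendre's recursion.\<close>
  have gen: "real (gen_totient 8 n) = (if \<alpha> = 0 then real (sifted P (2 ^ 0 * m div 8))
    else real (sifted P (2 ^ \<alpha> * m div 8)) - real (sifted P (2 ^ (\<alpha> - 1) * m div 8)))"
  proof (cases \<alpha>)
    case 0
    then show ?thesis
      unfolding gen_totient_eq_sifted[OF \<open>n > 0\<close>] pfs by (simp add: n)
  next
    case (Suc j)
    have "2 ^ \<alpha> * m div 8 div 2 = 2 * (2 ^ j * m) div (2 * 8)"
      by (simp add: Suc div_mult2_eq[symmetric] ac_simps)
    also have "\<dots> = 2 ^ j * m div 8" by (rule div_mult_mult1) simp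
    finally show ?thesis
      using sifted_insert[of 2 P "2 ^ \<alpha> * m div 8"] P \<open>2 \<notin> P\<close>
      unfolding gen_totient_eq_sifted[OF \<open>n > 0\<close>] pfs by (simp add: n Suc)
  qed
  \<comment> \<open>The coefficients (d, e) are (1, 2), (2, 0), (0, 0) for \<open>b = 0\<close>,
    \<open>b = 1\<close>, \<open>b \<ge> 2\<close>. For \<open>\<alpha> > 0\<close> those at
    \<open>\<alpha> - 1\<close> are subtracted from those at \<open>\<alpha>\<close>.\<close>
  have main: "8 * real (gen_totient 8 n) = real (totient n) +
    (if \<alpha> = 0 then B4 + 2 * B8 else if \<alpha> = 1 then B4 - 2 * B8 else if \<alpha> = 2 then - 2 * B4 else 0)"
  proof -
    consider "\<alpha> = 0" | "\<alpha> = 1" | "\<alpha> = 2" | "\<alpha> = 3" | "\<alpha> \<ge> 4" by linarith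
    then show ?thesis
    proof cases
      case 1
      then show ?thesis using S0 by (simp add: gen tot)
    next
      case 2
      then show ?thesis using S0 S1 by (simp add: gen tot)
    next
      case 3
      then show ?thesis using S1 S2 by (simp add: gen tot)
    next
      case 4
      then show ?thesis using S2 S3[of 3] by (simp add: gen tot)
    next
      case 5
      then obtain j where "\<alpha> = Suc j" "j \<ge> 3" by (cases \<alpha>) auto
      then show ?thesis using S3[of \<alpha>] S3[of j] by (simp add: gen tot)
    qed
  qed

  \<comment> \<open>Comparison with the stated cases\<close>
  have subset_iff: "R \<subseteq> {3, 7} \<longleftrightarrow> R = {3, 7} \<or> R = {3} \<or> R = {7}"
    "R \<subseteq> {5, 7} \<longleftrightarrow> R = {5, 7} \<or> R = {5} \<or> R = {7}"
    using \<open>R \<noteq> {}\<close> by auto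
  have gen': "real (gen_totient 8 n) = 1 / 8 * real (totient n) + 1 / 8 * (if \<alpha> = 0 then B4 + 2 * B8
      else if \<alpha> = 1 then B4 - 2 * B8 else if \<alpha> = 2 then - 2 * B4 else 0)"
    using main by linarith
  consider "\<alpha> = 0" | "\<alpha> = 1" | "\<alpha> = 2" | "\<alpha> \<ge> 3" by linarith
  note \<alpha>_cases = this
  consider "R = {5, 7} \<or> R = {5}" | "R = {3, 7} \<or> R = {3}" | "R = {7}"
    | "\<not> R \<subseteq> {3, 7}" "\<not> R \<subseteq> {5, 7}"
    unfolding subset_iff by blast
  then show ?thesis
  proof cases
    case 1
    then have B: "B4 = 0" "B8 = A" by (auto simp: B4_def B8_def)
    from 1 have "5 \<in> R" by auto
    then have R': "(R = {3, 7} \<or> R = {3}) = False" "(R = {7}) = False" by auto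
    show ?thesis
      unfolding gen' B Omega omega A_def R' using \<alpha>_cases by cases (simp_all add: 1)
  next
    case 2
    then have B: "B4 = A" "B8 = 0" by (auto simp: B4_def B8_def)
    from 2 have "3 \<in> R" by auto
    then have R': "(R = {5, 7} \<or> R = {5}) = False" by auto
    show ?thesis
      \<comment> \<open>For \<open>\<alpha> = 2\<close> the factor -2 of \<open>B4\<close> is
        absorbed by the extra prime 2 in omega(n) and by the sign shift in the exponent.\<close>
      unfolding gen' B Omega omega A_def R' using \<alpha>_cases by cases (simp_all add: 2 power_int_add)
  next
    case 3
    \<comment> \<open>Both characters contribute: the correction is 3A, -A, -2A for
      \<open>\<alpha>\<close> = 0, 1, 2, and the last summand of the claim is nonzero only for
      \<open>\<alpha> = 0\<close>.\<close>
    then have B: "B4 = A" "B8 = A" by (auto simp: B4_def B8_def)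
    from 3 have "3 \<notin> R" "5 \<notin> R" by auto
    then have R': "(R = {5, 7} \<or> R = {5}) = False" "(R = {3, 7} \<or> R = {3}) = False"
      by auto
    show ?thesis
      unfolding gen' B Omega omega A_def R' using \<alpha>_cases by cases (simp_all add: 3 power_int_add)
  next
    case 4
    then have B: "B4 = 0" "B8 = 0" by (auto simp: B4_def B8_def)
    with 4 show ?thesis unfolding gen' B subset_iff by simp
  qed
qed

end
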